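(* Let $ABC$ be a triangle inscribed in a circle $\Gamma$, and let $D_4$ be a point, distinct from $A,B,C$ and from the orthocentre of $ABC$. Let $\mathcal{C}$ be a central conic (an ellipse or a hyperbola), with centre $M$, passing through $A, B, C, D_4$ and such that the image $D$ of $D_4$ under the $180^\circ$ rotation about $M$ lies on $\Gamma$ and is distinct from $A,B,C$. Let $A_1, B_2, C_3$ be the images of $A, B, C$ respectively under the $180^\circ$ rotation about $M$. Let $P$ be a point of $\mathcal{C}$, not on $\Gamma$ or on the side lines of $ABC$, and distinct from $A_1,B_2,C_3,D_4$. Define $$A_4=A_1P\cap AD_4,\quad B_4=B_2P\cap BD_4,\quad C_4=C_3P\cap CD_4,$$ $$B_1=B_2P\cap BA_1,\quad C_1=C_3P\cap CA_1,\quad D_1=D_4P\cap DA_1,$$ $$A_2=A_1P\cap AB_2,\quad C_2=C_3P\cap CB_2,\quad D_2=D_4P\cap DB_2,$$ $$A_3=A_1P\cap AC_3,\quad B_3=B_2P\cap BC_3,\quad D_3=D_4P\cap DC_3,$$ and let $\Sigma_4$, $\Sigma_1$, $\Sigma_2$, $\Sigma_3$ be the circles $A_4B_4C_4$, $B_1C_1D_1$, $A_2C_2D_2$, $A_3B_3D_3$ respectively. Let $Q_k$ and $r_k$ be the centre and radius of $\Sigma_k$ for $k=1,2,3,4$. Then $Q_1,Q_2,Q_3,Q_4$ are collinear, and the radii are in proportion to the distances of the centres from $P$, i.e. $r_j\cdot |PQ_k| = r_k\cdot |PQ_j|$ for all $j,k\in\{1,2,3,4\}$.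
   Context: All objects lie in the Euclidean plane. For distinct points $R,S$, $RS$ denotes the line through them, $|RS|$ denotes the distance between points $R$ and $S$, and for non-collinear points $R,S,T$, circle $RST$ is the circle through them. Conics are non-degenerate. The configuration is assumed non-degenerate: each line named joins two distinct points, each pair of lines named meets in exactly one point, and the triples of points defining $\Sigma_1,\Sigma_2,\Sigma_3,\Sigma_4$ are not collinear. *)

theory Defs
  imports "HOL-Analysis.Analysis"
begin

definition half_turn :: "real^2 \<Rightarrow> real^2 \<Rightarrow> real^2" where
  "half_turn M X = 2 *\<^sub>R M - X"

(* H lies on the three altitudes; for a non-degenerate triangle this determines H. *)
definition is_orthocentre :: "real^2 \<Rightarrow> real^2 \<Rightarrow> real^2 \<Rightarrow> real^2 \<Rightarrow> bool" where
  "is_orthocentre A B C H \<longleftrightarrow>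
     (H - A) \<bullet> (B - C) = 0 \<and> (H - B) \<bullet> (C - A) = 0 \<and> (H - C) \<bullet> (A - B) = 0"

(* The equations x^2/a^2 + y^2/b^2 = 1 and x^2/a^2 - y^2/b^2 = 1 in the orthonormal frame
   (u, v) with origin M. There is no order between a and b, so circles count as ellipses. *)
definition ellipse_with_centre :: "(real^2) set \<Rightarrow> real^2 \<Rightarrow> bool" where
  "ellipse_with_centre K M \<longleftrightarrow>
     (\<exists>u v a b. norm u = 1 \<and> norm v = 1 \<and> u \<bullet> v = 0 \<and> a > 0 \<and> b > 0 \<and>
        K = {X. ((X - M) \<bullet> u)\<^sup>2 / a\<^sup>2 + ((X - M) \<bullet> v)\<^sup>2 / b\<^sup>2 = 1})"

definition hyperbola_with_centre :: "(real^2) set \<Rightarrow> real^2 \<Rightarrow> bool" where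
  "hyperbola_with_centre K M \<longleftrightarrow>
     (\<exists>u v a b. norm u = 1 \<and> norm v = 1 \<and> u \<bullet> v = 0 \<and> a > 0 \<and> b > 0 \<and>
        K = {X. ((X - M) \<bullet> u)\<^sup>2 / a\<^sup>2 - ((X - M) \<bullet> v)\<^sup>2 / b\<^sup>2 = 1})"

definition central_conic :: "(real^2) set \<Rightarrow> real^2 \<Rightarrow> bool" where
  "central_conic K M \<longleftrightarrow> ellipse_with_centre K M \<or> hyperbola_with_centre K M"

(* The non-degenerate reading of "X is the intersection of the lines RS and TU":
   both lines are genuine and X is their only common point. *)
definition lines_meet_at :: "real^2 \<Rightarrow> real^2 \<Rightarrow> real^2 \<Rightarrow> real^2 \<Rightarrow> real^2 \<Rightarrow> bool" where
  "lines_meet_at R S T U X \<longleftrightarrow>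
     R \<noteq> S \<and> T \<noteq> U \<and> affine hull {R, S} \<inter> affine hull {T, U} = {X}"

(* The circle RST has centre q and radius \<rho>. *)
definition circle_through :: "real^2 \<Rightarrow> real^2 \<Rightarrow> real^2 \<Rightarrow> real^2 \<Rightarrow> real \<Rightarrow> bool" where
  "circle_through R S T q \<rho> \<longleftrightarrow> \<not> collinear {R, S, T} \<and> {R, S, T} \<subseteq> sphere q \<rho>"

end

theory Submission
  imports Defs
begin

text \<open>
  Write \<open>X\<^sub>1, X\<^sub>2, X\<^sub>3, X\<^sub>4\<close> for \<open>A, B, C, D\<close> and \<open>X'\<close> for the half-turn of \<open>X\<close> about the
  centre \<open>M\<close>. All twelve intersection points have the same form
  \<open>Y\<^sub>i\<^sub>j = X\<^sub>i'P \<inter> X\<^sub>iX\<^sub>j'\<close>, and the circle with index \<open>j\<close> passes through the three points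
  \<open>Y\<^sub>i\<^sub>j\<close> with \<open>i \<noteq> j\<close>. The configuration is thus symmetric in four concyclic points of the conic.

  In coordinates along the axes the conic is \<open>\<alpha>x\<^sup>2 + \<beta>y\<^sup>2 = 1\<close>, with \<open>\<alpha>\<close>, \<open>\<beta>\<close> non-zero. Let
  \<open>J (x, y) = (- \<beta>y, \<alpha>x)\<close>; it sends each direction to the conjugate direction. If the conic is the
  unit circle, then \<open>J\<close> is the quarter turn, \<open>PX\<^sub>i'\<close> is perpendicular to \<open>PX\<^sub>i\<close>, and \<open>X\<^sub>iX\<^sub>j'\<close>
  is perpendicular to \<open>X\<^sub>iX\<^sub>j\<close>. Hence the triangle
  \<open>X\<^sub>iPY\<^sub>i\<^sub>j\<close>, right-angled at \<open>P\<close>, gives \<open>PY\<^sub>i\<^sub>j = PX\<^sub>i \<cdot> cot (\<angle>PX\<^sub>iX\<^sub>j)\<close> up to sign, and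
  the inscribed angle \<open>\<angle>PX\<^sub>iX\<^sub>j\<close> over the chord \<open>PX\<^sub>j\<close> does not depend on \<open>X\<^sub>i\<close>. Restated
  algebraically, this reads \<open>Y\<^sub>i\<^sub>j = P + c\<^sub>j J (X\<^sub>i - P)\<close> with a factor \<open>c\<^sub>j\<close> that depends only on
  \<open>P\<close> and \<open>X\<^sub>j\<close>, and in this form it holds for every central conic
  (lemma \<open>meet_eq_homothetic_image\<close>).

  The points \<open>J X\<^sub>i\<close> lie on one circle, because the \<open>X\<^sub>i\<close> lie both on the conic and on \<open>\<Gamma>\<close>
  (lemma \<open>conjugate_image_on_circle\<close>). Therefore the four circles are the images of a single circle,
  with centre \<open>P + V\<close> and radius \<open>R\<close> say, under the homotheties with centre \<open>P\<close> and ratios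
  \<open>c\<^sub>j\<close>. Their centres \<open>P + c\<^sub>j V\<close> lie on a line through \<open>P\<close>, and their radii
  \<open>\<bar>c\<^sub>j\<bar> R\<close> are proportional to the distances \<open>\<bar>c\<^sub>j\<bar> \<parallel>V\<parallel>\<close>.
\<close>

section \<open>Circles through three points\<close>

text \<open>The common points of two circles with distinct centres lie on a line, the radical axis; so
  three non-collinear points admit one centre only.\<close>

lemma circle_through_unique:
  assumes circ: "circle_through R S T q \<rho>" and on: "{R, S, T} \<subseteq> sphere q' \<rho>'"
  shows "q = q'" "\<rho> = \<rho>'"
proof -
  have nc: "\<not> collinear {R, S, T}" and on': "{R, S, T} \<subseteq> sphere q \<rho>"
    using circ by (auto simp: circle_through_def)
  show "q = q'"
  proof (rule ccontr)
    assume "q \<noteq> q'"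
    then have ne: "2 *\<^sub>R (q - q') \<noteq> 0" by simp
    let ?k = "q \<bullet> q - q' \<bullet> q' - \<rho>\<^sup>2 + \<rho>'\<^sup>2"
    have "(2 *\<^sub>R (q - q')) \<bullet> X = ?k" if "X \<in> {R, S, T}" for X
    proof -
      have "dist q X = \<rho>" "dist q' X = \<rho>'" using on on' that by auto
      then have "(q - X) \<bullet> (q - X) = \<rho>\<^sup>2" "(q' - X) \<bullet> (q' - X) = \<rho>'\<^sup>2"
        by (auto simp: dist_norm power2_norm_eq_inner[symmetric])
      then show ?thesis by (simp add: inner_diff inner_commute algebra_simps)
    qed
    then have "{R, S, T} \<subseteq> {X. (2 *\<^sub>R (q - q')) \<bullet> X = ?k}" by blast
    then have "aff_dim {R, S, T} \<le> aff_dim {X. (2 *\<^sub>R (q - q')) \<bullet> X = ?k}"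
      by (rule aff_dim_subset)
    also have "\<dots> = 1" using aff_dim_hyperplane[OF ne, of ?k] by simp
    finally show False using nc by (simp add: collinear_aff_dim)
  qed
  then show "\<rho> = \<rho>'" using on on' by auto
qed

lemma circle_through_homothetic_image:
  assumes circ: "circle_through (P + c *\<^sub>R W1) (P + c *\<^sub>R W2) (P + c *\<^sub>R W3) q \<rho>"
    and W: "dist W1 V = R" "dist W2 V = R" "dist W3 V = R"
  shows "q = P + c *\<^sub>R V \<and> \<rho> = \<bar>c\<bar> * R"
proof -
  have "dist (P + c *\<^sub>R V) (P + c *\<^sub>R W) = \<bar>c\<bar> * dist W V" for W
    by (simp add: dist_norm norm_minus_commute flip: scaleR_diff_right)
  then have "{P + c *\<^sub>R W1, P + c *\<^sub>R W2, P + c *\<^sub>R W3} \<subseteq> sphere (P + c *\<^sub>R V) (\<bar>c\<bar> * R)"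
    using W by auto
  from circle_through_unique[OF circ this] show ?thesis by simp
qed

section \<open>Conjugate directions in the frame of the axes\<close>

locale conic_frame =
  fixes M u v :: "real^2" and \<alpha> \<beta> :: real
  assumes orthonormal: "norm u = 1" "norm v = 1" "u \<bullet> v = 0"
    and nondegenerate: "\<alpha> \<noteq> 0" "\<beta> \<noteq> 0"
begin

definition form :: "real^2 \<Rightarrow> real^2 \<Rightarrow> real" where
  "form X Y = \<alpha> * (X \<bullet> u) * (Y \<bullet> u) + \<beta> * (X \<bullet> v) * (Y \<bullet> v)"

definition area :: "real^2 \<Rightarrow> real^2 \<Rightarrow> real" where
  "area X Y = (X \<bullet> u) * (Y \<bullet> v) - (X \<bullet> v) * (Y \<bullet> u)"

text \<open>The map is normalised by \<open>J\<^sup>2 = - \<alpha>\<beta>\<close> instead of \<open>J\<^sup>2 = \<plusminus>1\<close>: no square roots are needed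
  and ellipses and hyperbolas are treated alike.\<close>

definition J :: "real^2 \<Rightarrow> real^2" where
  "J X = (- \<beta> * (X \<bullet> v)) *\<^sub>R u + (\<alpha> * (X \<bullet> u)) *\<^sub>R v"

definition conic :: "(real^2) set" where
  "conic = {X. form (X - M) (X - M) = 1}"

text \<open>For the unit circle this is the cotangent of half the angle from \<open>P\<close> to \<open>X\<close>, that is, of the
  inscribed angle over the chord \<open>PX\<close>.\<close>

definition ratio :: "real^2 \<Rightarrow> real^2 \<Rightarrow> real" where
  "ratio P X = (1 + form (P - M) (X - M)) / (\<alpha> * \<beta> * area (P - M) (X - M))"

lemma frame_inner [simp]:
  "u \<bullet> u = 1" "v \<bullet> v = 1" "u \<bullet> v = 0" "v \<bullet> u = 0"
  using orthonormal by (auto simp: norm_eq_1 inner_commute)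

lemma frame_expansion: "X = (X \<bullet> u) *\<^sub>R u + (X \<bullet> v) *\<^sub>R v"
proof -
  let ?d = "X - ((X \<bullet> u) *\<^sub>R u + (X \<bullet> v) *\<^sub>R v)"
  have "?d \<bullet> u = 0" "?d \<bullet> v = 0" by (simp_all add: inner_diff_left inner_add_left)
  then have d: "?d $ 1 * u $ 1 + ?d $ 2 * u $ 2 = 0" "?d $ 1 * v $ 1 + ?d $ 2 * v $ 2 = 0"
    by (simp_all only: inner_vec_def sum_2 inner_real_def)
  have uv: "u $ 1 * u $ 1 + u $ 2 * u $ 2 = 1" "v $ 1 * v $ 1 + v $ 2 * v $ 2 = 1"
      "u $ 1 * v $ 1 + u $ 2 * v $ 2 = 0"
    using frame_inner(1-3) by (simp_all only: inner_vec_def sum_2 inner_real_def)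
  have "?d $ 1 = 0" "?d $ 2 = 0"
    using d uv by algebra+
  then have "?d = 0" by (simp only: vec_eq_iff forall_2 zero_index)
  then show ?thesis by simp
qed

lemma frame_eqI:
  assumes "X \<bullet> u = Y \<bullet> u" "X \<bullet> v = Y \<bullet> v"
  shows "X = Y"
  using frame_expansion[of X] frame_expansion[of Y] assms by simp

lemma dist_frame: "(dist X Y)\<^sup>2 = (X \<bullet> u - Y \<bullet> u)\<^sup>2 + (X \<bullet> v - Y \<bullet> v)\<^sup>2"
proof -
  have "(dist X Y)\<^sup>2 = (X - Y) \<bullet> (X - Y)"
    by (simp add: dist_norm power2_norm_eq_inner)
  also have "\<dots> = ((X - Y) \<bullet> u)\<^sup>2 + ((X - Y) \<bullet> v)\<^sup>2"
    by (subst (1 2) frame_expansion[of "X - Y"])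
      (simp add: inner_add_left inner_add_right power2_eq_square)
  finally show ?thesis by (simp add: inner_diff_left)
qed

lemma J_inner: "J X \<bullet> u = - \<beta> * (X \<bullet> v)" "J X \<bullet> v = \<alpha> * (X \<bullet> u)"
  by (simp_all add: J_def inner_add_left inner_diff_left)

lemma J_diff: "J (X - Y) = J X - J Y"
  by (simp add: J_def inner_diff_left algebra_simps)

lemma form_simps:
  "form (X + Y) Z = form X Z + form Y Z" "form Z (X + Y) = form Z X + form Z Y"
  "form (X - Y) Z = form X Z - form Y Z" "form Z (X - Y) = form Z X - form Z Y"
  by (simp_all add: form_def inner_add_left inner_diff_left algebra_simps)

lemma form_commute: "form X Y = form Y X"
  by (simp add: form_def algebra_simps)

lemma area_add_left: "area (X + Y) Z = area X Z + area Y Z"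
  by (simp add: area_def inner_add_left algebra_simps)

lemma area_minus_right: "area X (- Y) = - area X Y"
  by (simp add: area_def)

lemma area_scaleR_left: "area (c *\<^sub>R X) Y = c * area X Y"
  by (simp add: area_def algebra_simps)

lemma area_J: "area (J X) Y = - form X Y"
  by (simp add: area_def form_def J_inner)

text \<open>The product rule for Gram determinants; it replaces trigonometric identities below.\<close>

lemma area_times_area:
  "\<alpha> * \<beta> * area X Y * area Z W = form X Z * form Y W - form X W * form Y Z"
  by (simp add: area_def form_def algebra_simps)

lemma parallel_if_area_zero:
  assumes "area X Y = 0" "Y \<noteq> 0"
  obtains k where "X = k *\<^sub>R Y"
proof (cases "Y \<bullet> u = 0")
  case False
  then have "X = ((X \<bullet> u) / (Y \<bullet> u)) *\<^sub>R Y"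
    using assms(1) by (intro frame_eqI) (auto simp: area_def field_simps)
  then show ?thesis by (rule that)
next
  case True
  then have "Y \<bullet> v \<noteq> 0" using assms(2) frame_eqI[of Y 0] by auto
  with True have "X = ((X \<bullet> v) / (Y \<bullet> v)) *\<^sub>R Y"
    using assms(1) by (intro frame_eqI) (auto simp: area_def field_simps)
  then show ?thesis by (rule that)
qed

lemma in_line_if_area_zero:
  assumes "area (Y - S) (T - S) = 0" "S \<noteq> T"
  shows "Y \<in> affine hull {S, T}"
proof -
  obtain k where "Y - S = k *\<^sub>R (T - S)"
    using parallel_if_area_zero assms by (metis right_minus_eq)
  then have "Y = S + k *\<^sub>R (T - S)" by (simp add: algebra_simps)
  then show ?thesis by (auto simp: affine_hull_2_alt)
qed

text \<open>A line through the centre meets the conic in at most two points, which are opposite.\<close>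

lemma area_nonzero:
  assumes on: "P \<in> conic" "X \<in> conic" and ne: "P \<noteq> X" "P \<noteq> half_turn M X"
  shows "area (P - M) (X - M) \<noteq> 0"
proof
  assume 0: "area (P - M) (X - M) = 0"
  have "X - M \<noteq> 0" using on by (auto simp: conic_def form_def)
  then obtain k where k: "P - M = k *\<^sub>R (X - M)" using 0 parallel_if_area_zero by blast
  have "form (k *\<^sub>R Y) (k *\<^sub>R Y) = k\<^sup>2 * form Y Y" for Y
    by (simp add: form_def power2_eq_square algebra_simps)
  then have "k\<^sup>2 = 1" using on k by (simp add: conic_def)
  then have "k = 1 \<or> k = -1" by (simp add: power2_eq_1_iff)
  with k ne show False by (auto simp: half_turn_def algebra_simps scaleR_2)
qed

section \<open>The intersection points and their circles\<close>

text \<open>The point \<open>P + ratio P Y \<cdot> J (X - P)\<close> lies on the line \<open>X'P\<close> because \<open>X + P\<close> and \<open>X - P\<close>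
  (as vectors from \<open>M\<close>) are conjugate. That it lies on \<open>XY'\<close> is, after the Gram product rule, an
  identity between the values of the form.\<close>

lemma meet_eq_homothetic_image:
  assumes on: "P \<in> conic" "X \<in> conic" "Y \<in> conic"
    and ne: "P \<noteq> Y" "P \<noteq> half_turn M Y"
    and meet: "lines_meet_at (half_turn M X) P X (half_turn M Y) I"
  shows "I = P + ratio P Y *\<^sub>R J (X - P)"
proof -
  define p x y where pxy: "p = P - M" "x = X - M" "y = Y - M"
  let ?c = "ratio P Y"
  let ?I = "P + ?c *\<^sub>R J (X - P)"
  have unit: "form p p = 1" "form x x = 1" "form y y = 1"
    using on by (simp_all add: conic_def pxy)
  have c: "?c * (\<alpha> * \<beta> * area p y) = 1 + form p y"
    using area_nonzero[OF on(1,3) ne] nondegenerate by (simp add: ratio_def pxy)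
  have nz: "\<alpha> * \<beta> * area p y \<noteq> 0"
    using area_nonzero[OF on(1,3) ne] nondegenerate by (simp add: pxy)
  have XP: "X - P = x - p" by (simp add: pxy)
  have "area (?I - P) (half_turn M X - P) = area (?c *\<^sub>R J (x - p)) (- (x + p))"
    by (simp add: XP) (simp add: pxy half_turn_def scaleR_2 algebra_simps)
  also have "\<dots> = 0"
    unfolding area_minus_right area_scaleR_left area_J
    using unit by (simp add: form_simps form_commute[of p x])
  finally have 1: "?I \<in> affine hull {P, half_turn M X}"
    using meet by (intro in_line_if_area_zero) (auto simp: lines_meet_at_def)
  have "(\<alpha> * \<beta> * area p y) * area (p - x) (x + y) = (1 + form p y) * form (x - p) (x + y)"
    unfolding area_times_area
    using unit form_commute[of y x] form_commute[of x p] form_commute[of y p]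
    by (simp add: form_simps algebra_simps)
  also have "\<dots> = (\<alpha> * \<beta> * area p y) * (?c * form (x - p) (x + y))"
    by (simp flip: c)
  finally have "area (p - x) (x + y) = ?c * form (x - p) (x + y)"
    using nz by (metis mult_left_cancel)
  then have 0: "area ((p - x) + ?c *\<^sub>R J (x - p)) (- (x + y)) = 0"
    by (simp only: area_minus_right area_add_left area_scaleR_left area_J)
  have "?I - X = (p - x) + ?c *\<^sub>R J (x - p)" by (simp add: XP) (simp add: pxy)
  moreover have "half_turn M Y - X = - (x + y)"
    by (simp add: pxy half_turn_def scaleR_2)
  ultimately have "area (?I - X) (half_turn M Y - X) = 0" using 0 by simp
  then have 2: "?I \<in> affine hull {X, half_turn M Y}"
    using meet by (intro in_line_if_area_zero) (auto simp: lines_meet_at_def)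
  show ?thesis using 1 2 meet by (auto simp: lines_meet_at_def insert_commute)
qed

text \<open>On the conic, \<open>\<alpha>\<^sup>2x\<^sup>2 + \<beta>\<^sup>2y\<^sup>2 = (\<alpha> + \<beta>) - \<alpha>\<beta>(x\<^sup>2 + y\<^sup>2)\<close>: up to a constant, the squared
  length of \<open>J X\<close> is a multiple of that of \<open>X\<close>. On a circle the latter is affine in \<open>X\<close>, hence the
  former is affine in \<open>J X\<close>, which is the equation of a circle.\<close>

lemma conjugate_image_on_circle:
  obtains V R where
    "\<And>X. X \<in> conic \<Longrightarrow> X \<in> sphere Z \<rho> \<Longrightarrow> dist (J (X - P)) V = R"
proof -
  define p q where pq: "p = (Z - M) \<bullet> u" "q = (Z - M) \<bullet> v"
  \<comment> \<open>Centre and squared radius come from completing the square in the equation of the circle.\<close>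
  define O' where "O' = (\<alpha> * q) *\<^sub>R u - (\<beta> * p) *\<^sub>R v"
  define k where
    "k = \<alpha> + \<beta> + \<alpha> * \<beta> * (p\<^sup>2 + q\<^sup>2 - \<rho>\<^sup>2) + (\<alpha> * q)\<^sup>2 + (\<beta> * p)\<^sup>2"
  have "dist (J (X - P)) (O' - J (P - M)) = sqrt k" if X: "X \<in> conic" "X \<in> sphere Z \<rho>" for X
  proof -
    define x y where xy: "x = (X - M) \<bullet> u" "y = (X - M) \<bullet> v"
    have con: "\<alpha> * x * x + \<beta> * y * y = 1" using X(1) by (simp add: conic_def form_def xy)
    have "(dist X Z)\<^sup>2 = \<rho>\<^sup>2" using X(2) by (simp add: dist_commute)
    then have circ: "(x - p)\<^sup>2 + (y - q)\<^sup>2 = \<rho>\<^sup>2"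
      by (simp add: dist_frame xy pq inner_diff_left)
    have "(dist (J (X - M)) O')\<^sup>2 = (- \<beta> * y - \<alpha> * q)\<^sup>2 + (\<alpha> * x + \<beta> * p)\<^sup>2"
      by (simp add: dist_frame J_inner xy O'_def inner_diff_left)
    also have "\<dots> = k"
      using con circ unfolding k_def by algebra
    finally have "dist (J (X - M)) O' = sqrt k" by (metis real_sqrt_unique zero_le_dist)
    moreover have "J (X - P) = J (X - M) - J (P - M)" by (simp flip: J_diff)
    ultimately show ?thesis by (simp add: dist_norm)
  qed
  then show ?thesis by (rule that)
qed

end

text \<open>Ellipses and hyperbolas differ only in the sign of \<open>\<beta>\<close>.\<close>

lemma central_conic_frame:
  assumes "central_conic K M"
  obtains u v \<alpha> \<beta> where "conic_frame u v \<alpha> \<beta>" "K = conic_frame.conic M u v \<alpha> \<beta>"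
proof -
  consider (ellipse) u v a b where "norm u = 1" "norm v = 1" "u \<bullet> v = 0" "a > 0" "b > 0"
      "K = {X. ((X - M) \<bullet> u)\<^sup>2 / a\<^sup>2 + ((X - M) \<bullet> v)\<^sup>2 / b\<^sup>2 = 1}"
    | (hyperbola) u v a b where "norm u = 1" "norm v = 1" "u \<bullet> v = 0" "a > 0" "b > 0"
      "K = {X. ((X - M) \<bullet> u)\<^sup>2 / a\<^sup>2 - ((X - M) \<bullet> v)\<^sup>2 / b\<^sup>2 = 1}"
    using assms
    unfolding central_conic_def ellipse_with_centre_def hyperbola_with_centre_def by blast
  then show ?thesis
  proof cases
    case ellipse
    interpret conic_frame M u v "1 / a\<^sup>2" "1 / b\<^sup>2" using ellipse by unfold_locales auto
    have "K = conic"
      unfolding conic_def form_def using ellipse(6) by (simp add: power2_eq_square)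
    then show ?thesis using that conic_frame_axioms by blast
  next
    case hyperbola
    interpret conic_frame M u v "1 / a\<^sup>2" "- 1 / b\<^sup>2" using hyperbola by unfold_locales auto
    have "K = conic"
      unfolding conic_def form_def using hyperbola(6) by (simp add: power2_eq_square)
    then show ?thesis using that conic_frame_axioms by blast
  qed
qed

theorem theorem7:
  fixes A B C D D4 M P A1 B2 C3 :: "real^2"
    and A4 B4 C4 B1 C1 D1 A2 C2 D2 A3 B3 D3 :: "real^2"
    and \<Gamma> \<C> :: "(real^2) set"
    and Z :: "real^2" and \<rho> :: real
    and Q :: "nat \<Rightarrow> real^2" and r :: "nat \<Rightarrow> real"
  assumes "\<not> collinear {A, B, C}"
    and "\<Gamma> = sphere Z \<rho>" and "A \<in> \<Gamma>" and "B \<in> \<Gamma>" and "C \<in> \<Gamma>"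
    and "D4 \<notin> {A, B, C}" and "\<not> is_orthocentre A B C D4"
    and "central_conic \<C> M"
    and "A \<in> \<C>" and "B \<in> \<C>" and "C \<in> \<C>" and "D4 \<in> \<C>"
    and "D = half_turn M D4" and "D \<in> \<Gamma>" and "D \<notin> {A, B, C}"
    and "A1 = half_turn M A" and "B2 = half_turn M B" and "C3 = half_turn M C"
    and "P \<in> \<C>" and "P \<notin> \<Gamma>"
    and "P \<notin> affine hull {A, B}" and "P \<notin> affine hull {B, C}" and "P \<notin> affine hull {C, A}"
    and "P \<notin> {A1, B2, C3, D4}"
    and "lines_meet_at A1 P A D4 A4" and "lines_meet_at B2 P B D4 B4" and "lines_meet_at C3 P C D4 C4"
    and "lines_meet_at B2 P B A1 B1" and "lines_meet_at C3 P C A1 C1" and "lines_meet_at D4 P D A1 D1"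
    and "lines_meet_at A1 P A B2 A2" and "lines_meet_at C3 P C B2 C2" and "lines_meet_at D4 P D B2 D2"
    and "lines_meet_at A1 P A C3 A3" and "lines_meet_at B2 P B C3 B3" and "lines_meet_at D4 P D C3 D3"
    and "circle_through A4 B4 C4 (Q 4) (r 4)"
    and "circle_through B1 C1 D1 (Q 1) (r 1)"
    and "circle_through A2 C2 D2 (Q 2) (r 2)"
    and "circle_through A3 B3 D3 (Q 3) (r 3)"
  shows "collinear {Q 1, Q 2, Q 3, Q 4} \<and>
         (\<forall>j \<in> {1, 2, 3, 4}. \<forall>k \<in> {1, 2, 3, 4}. r j * dist P (Q k) = r k * dist P (Q j))"
proof -
  obtain u v \<alpha> \<beta> where fr: "conic_frame u v \<alpha> \<beta>" and K: "\<C> = conic_frame.conic M u v \<alpha> \<beta>"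
    using central_conic_frame[OF \<open>central_conic \<C> M\<close>] by blast
  interpret conic_frame M u v \<alpha> \<beta> by (rule fr)
  have inv: "half_turn M D = D4"
    using \<open>D = half_turn M D4\<close> by (simp add: half_turn_def)
  have "D - M = - (D4 - M)"
    using \<open>D = half_turn M D4\<close> by (simp add: half_turn_def scaleR_2)
  then have "form (D - M) (D - M) = form (D4 - M) (D4 - M)"
    by (simp only: form_def inner_minus_left mult_minus_left mult_minus_right minus_minus)
  then have con: "A \<in> conic" "B \<in> conic" "C \<in> conic" "D \<in> conic" "P \<in> conic"
    using assms(9-12,19) K by (simp_all add: conic_def)
  have neq: "P \<noteq> A" "P \<noteq> B" "P \<noteq> C" "P \<noteq> D"
    using \<open>P \<notin> \<Gamma>\<close> \<open>A \<in> \<Gamma>\<close> \<open>B \<in> \<Gamma>\<close> \<open>C \<in> \<Gamma>\<close> \<open>D \<in> \<Gamma>\<close> by auto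
  have neq': "P \<noteq> half_turn M A" "P \<noteq> half_turn M B" "P \<noteq> half_turn M C" "P \<noteq> half_turn M D"
    using \<open>P \<notin> {A1, B2, C3, D4}\<close> assms(16-18) inv by auto
  obtain V R where VR: "\<And>X. X \<in> conic \<Longrightarrow> X \<in> sphere Z \<rho> \<Longrightarrow> dist (J (X - P)) V = R"
    using conjugate_image_on_circle by blast
  have W: "dist (J (A - P)) V = R" "dist (J (B - P)) V = R" "dist (J (C - P)) V = R"
      "dist (J (D - P)) V = R"
    using con assms(2-5,14) VR by auto
  note meets = assms(25-36)[unfolded assms(16-18), folded inv]
  note img = meet_eq_homothetic_image[OF con(5)]
  have Y4: "A4 = P + ratio P D *\<^sub>R J (A - P)" "B4 = P + ratio P D *\<^sub>R J (B - P)"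
      "C4 = P + ratio P D *\<^sub>R J (C - P)"
    using img con neq neq' meets by blast+
  have Y1: "B1 = P + ratio P A *\<^sub>R J (B - P)" "C1 = P + ratio P A *\<^sub>R J (C - P)"
      "D1 = P + ratio P A *\<^sub>R J (D - P)"
    using img con neq neq' meets by blast+
  have Y2: "A2 = P + ratio P B *\<^sub>R J (A - P)" "C2 = P + ratio P B *\<^sub>R J (C - P)"
      "D2 = P + ratio P B *\<^sub>R J (D - P)"
    using img con neq neq' meets by blast+
  have Y3: "A3 = P + ratio P C *\<^sub>R J (A - P)" "B3 = P + ratio P C *\<^sub>R J (B - P)"
      "D3 = P + ratio P C *\<^sub>R J (D - P)"
    using img con neq neq' meets by blast+
  define c where
    "c k = (if k = 1 then ratio P A else if k = 2 then ratio P B else if k = 3 then ratio P C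
            else ratio P D)" for k :: nat
  have QR: "Q k = P + c k *\<^sub>R V \<and> r k = \<bar>c k\<bar> * R" if "k \<in> {1, 2, 3, 4}" for k
    using that W assms(37-40)[unfolded Y1 Y2 Y3 Y4]
    by (auto simp: c_def dest: circle_through_homothetic_image)
  have "collinear {Q 1, Q 2, Q 3, Q 4}"
    unfolding collinear_alt
    by (rule exI[of _ P], rule exI[of _ V]) (auto simp: QR)
  moreover have "dist P (Q k) = \<bar>c k\<bar> * norm V" if "k \<in> {1, 2, 3, 4}" for k
    using QR[OF that] by (simp add: dist_norm)
  ultimately show ?thesis using QR by simp
qed

end
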